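(* Let $q\geq 2$ be an integer. Let $f(X)\in\mathbb{Z}[X]$ be a polynomial of degree $d\geq 1$ with $f(\mathbb{N})\subset\mathbb{N}$, where $\mathbb{N}=\{0,1,2,\ldots\}$. Let $w$ be a word of length $l\geq 1$ over the alphabet $\{0,1,\ldots,q-1\}$. Then $$\limsup_{n\to\infty}\frac{e_q(w;f(n))}{\log n}\geq\frac{\gamma(w)}{l\log q}.$$
   Context: For an integer $n\geq 1$ with base-$q$ expansion $n=\sum_{i=0}^{M}n_iq^i$, where $n_i\in\{0,\ldots,q-1\}$ and $M=\lfloor\log_q n\rfloor$ is the position of the most significant digit (so there are no leading zeros), write $(n)_q=n_Mn_{M-1}\cdots n_0$, regarded as a word over $\{0,1,\ldots,q-1\}$; also $(0)_q:=0$ (the one-letter word). For a nonempty finite word $w$ over $\{0,\ldots,q-1\}$, $e_q(w;n)$ denotes the number of (possibly overlapping) occurrences of $w$ as a block of consecutive letters in the word $(n)_q$. For example $e_{10}(202;20202)=2$. The word $w^2$ is the concatenation $ww$. Let $\gamma'(w)$ be the number of (possibly overlapping) occurrences of $w$ as a block of consecutive letters in $w^2$, and put $\gamma(w)=\gamma'(w)-1$. For example $\gamma(2020)=2$ and $\gamma(0^l)=\gamma((q-1)^l)=l$. *)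

theory Defs
  imports
    "HOL-Analysis.Analysis"
    "HOL-Computational_Algebra.Polynomial"
begin

text \<open>Words are lists of naturals, written most significant digit first. The \<open>i\<close>-th
  base-\<open>q\<close> digit of \<open>n\<close> is \<open>n div q ^ i mod q\<close>; the list below runs from
  the digit of index \<open>\<lfloor>log\<^sub>q n\<rfloor>\<close> down to the digit of index \<open>0\<close>.\<close>

definition base_word :: "nat \<Rightarrow> nat \<Rightarrow> nat list" where
  "base_word q n =
     (if n = 0 then [0]
      else rev (map (\<lambda>i. n div q ^ i mod q) [0..<Suc (nat \<lfloor>log (real q) (real n)\<rfloor>)]))"

text \<open>Overlapping occurrences are counted, by their starting positions.
  For empty \<open>u\<close> every position of \<open>v\<close>, including the end, counts.\<close>

definition occurrences :: "'a list \<Rightarrow> 'a list \<Rightarrow> nat" where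
  "occurrences u v =
     card {i. i + length u \<le> length v \<and> take (length u) (drop i v) = u}"

definition digit_block_count :: "nat \<Rightarrow> nat list \<Rightarrow> nat \<Rightarrow> nat" where
  "digit_block_count q w n = occurrences w (base_word q n)"

definition word_gamma' :: "'a list \<Rightarrow> nat" where
  "word_gamma' w = occurrences w (w @ w)"

definition word_gamma :: "'a list \<Rightarrow> nat" where
  "word_gamma w = word_gamma' w - 1"

text \<open>The natural-number subtraction in \<^const>\<open>word_gamma\<close> never truncates.\<close>

lemma word_gamma'_pos: "word_gamma' w \<ge> 1"
proof -
  let ?S = "{i. i + length w \<le> length (w @ w) \<and> take (length w) (drop i (w @ w)) = w}"
  have "finite ?S"
    by (rule finite_subset[of _ "{..length w}"]) auto
  moreover have "0 \<in> ?S" by simp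
  ultimately have "card ?S > 0" by (metis card_gt_0_iff empty_iff)
  then show ?thesis by (simp add: word_gamma'_def occurrences_def)
qed

text \<open>\<^const>\<open>base_word\<close> is the expansion of \<open>n\<close> without leading zeros.\<close>

lemma base_word_letters: "q \<ge> 2 \<Longrightarrow> set (base_word q n) \<subseteq> {..<q}"
  by (auto simp: base_word_def)

lemma sum_digits: "(\<Sum>i<k. (n div q ^ i mod q) * q ^ i) = (n::nat) mod q ^ k"
proof (induction k)
  case (Suc k)
  then show ?case using mod_mult2_eq[of n "q ^ k" q]
    by (simp add: mult.commute)
qed simp

lemma power_floor_log_bounds:
  assumes "q \<ge> 2" "n > 0"
  shows "q ^ nat \<lfloor>log (real q) (real n)\<rfloor> \<le> n"
    and "n < q ^ Suc (nat \<lfloor>log (real q) (real n)\<rfloor>)"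
proof -
  have nn: "log (real q) (real n) \<ge> 0" using assms by simp
  have "\<lfloor>log (real q) (real n)\<rfloor> = int (nat \<lfloor>log (real q) (real n)\<rfloor>)" using nn by simp
  then have "q ^ nat \<lfloor>log (real q) (real n)\<rfloor> \<le> n \<and>
      n < q ^ (nat \<lfloor>log (real q) (real n)\<rfloor> + 1)"
    using floor_log_nat_eq_powr_iff[OF assms] by blast
  then show "q ^ nat \<lfloor>log (real q) (real n)\<rfloor> \<le> n"
    and "n < q ^ Suc (nat \<lfloor>log (real q) (real n)\<rfloor>)" by simp_all
qed

lemma base_word_value:
  assumes "q \<ge> 2"
  shows "(\<Sum>i<length (base_word q n). rev (base_word q n) ! i * q ^ i) = n"
proof (cases "n = 0")
  case True
  then show ?thesis by (simp add: base_word_def)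
next
  case False
  let ?k = "Suc (nat \<lfloor>log (real q) (real n)\<rfloor>)"
  have len: "length (base_word q n) = ?k"
    using False by (simp add: base_word_def)
  have rv: "rev (base_word q n) = map (\<lambda>i. n div q ^ i mod q) [0..<?k]"
    using False by (simp add: base_word_def del: upt_Suc)
  have "(\<Sum>i<length (base_word q n). rev (base_word q n) ! i * q ^ i)
      = (\<Sum>i<?k. (n div q ^ i mod q) * q ^ i)"
    unfolding len rv by (rule sum.cong) (auto simp del: upt_Suc)
  also have "\<dots> = n"
    unfolding sum_digits using power_floor_log_bounds(2)[OF assms] False by simp
  finally show ?thesis .
qed

lemma hd_base_word_nonzero:
  assumes "q \<ge> 2" "n > 0"
  shows "hd (base_word q n) \<noteq> 0"
proof -
  let ?m = "nat \<lfloor>log (real q) (real n)\<rfloor>"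
  have "n div q ^ ?m < q" "n div q ^ ?m > 0"
    using power_floor_log_bounds[OF assms] assms
    by (simp_all add: less_mult_imp_div_less div_greater_zero_iff)
  then show ?thesis using assms by (simp add: base_word_def)
qed

end

theory Submission
  imports Defs "HOL-Real_Asymp.Real_Asymp"
begin

text \<open>Consecutive values \<open>f 0, \<dots>, f N\<close> have gaps \<open>O(N ^ (d - 1))\<close>, whereas \<open>f N\<close> has order
  \<open>N ^ d\<close>; hence for suitable \<open>n \<le> N\<close> the leading \<open>log\<^sub>q N - O(1)\<close> digits of \<open>f n\<close> can be
  prescribed. Prescribing \<open>1ww\<dots>w\<close>, where the \<open>1\<close> guards against leading zeros, makes \<open>w\<close> occur
  \<open>\<gamma>(w)\<close> times per \<open>l\<close> prescribed digits.\<close>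

section \<open>Base-\<open>q\<close> words under division and Horner evaluation\<close>

lemma base_word_snoc:
  assumes "q \<ge> 2" "n > 0" "a < q"
  shows "base_word q (n * q + a) = base_word q n @ [a]"
proof -
  define k where "k = nat \<lfloor>log (real q) (real n)\<rfloor>"
  have "q ^ k \<le> n" "n < q ^ Suc k"
    using power_floor_log_bounds[OF assms(1,2)] by (simp_all add: k_def)
  moreover have "n * q + a < q ^ Suc k * q"
  proof -
    have "n * q + a < Suc n * q" using assms by simp
    also have "\<dots> \<le> q ^ Suc k * q" using \<open>n < q ^ Suc k\<close> by (intro mult_right_mono) auto
    finally show ?thesis .
  qed
  moreover have "q ^ k * q \<le> n * q + a"
    using \<open>q ^ k \<le> n\<close> by (simp add: trans_le_add1)
  ultimately have "q ^ Suc k \<le> n * q + a \<and> n * q + a < q ^ (Suc k + 1)"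
    by (simp add: mult.commute mult.left_commute)
  then have fl: "\<lfloor>log (real q) (real (n * q + a))\<rfloor> = int (Suc k)"
    using floor_log_nat_eq_powr_iff[of q "n * q + a" "Suc k"] assms by simp
  have dig: "(n * q + a) div q ^ Suc i = n div q ^ i" for i
    using assms by (simp add: div_mult2_eq)
  have upt: "[0..<Suc (Suc k)] = 0 # map Suc [0..<Suc k]"
    by (simp add: upt_conv_Cons map_Suc_upt del: upt_Suc)
  have "base_word q (n * q + a)
      = rev (map (\<lambda>i. (n * q + a) div q ^ i mod q) [0..<Suc (Suc k)])"
    using assms fl by (simp add: base_word_def del: upt_Suc of_nat_add of_nat_mult of_nat_Suc)
  also have "\<dots> = rev (map (\<lambda>i. n div q ^ i mod q) [0..<Suc k]) @ [a]"
    unfolding upt using assms(3) by (simp add: dig o_def del: upt_Suc power_Suc)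
  also have "\<dots> = base_word q n @ [a]"
    using assms(2) by (simp add: base_word_def k_def del: upt_Suc)
  finally show ?thesis .
qed

text \<open>Each division by \<open>q\<close> drops the last letter, by
  \<open>base_word_snoc\<close>. The quotient must stay positive because
  \<open>base_word q 0\<close> is \<open>[0]\<close> and not the empty word.\<close>

lemma base_word_prefix:
  assumes "q \<ge> 2" "n div q ^ m > 0"
  shows "\<exists>v. base_word q n = base_word q (n div q ^ m) @ v"
  using assms(2)
proof (induction m arbitrary: n)
  case (Suc m)
  have eq: "n div q ^ Suc m = n div q div q ^ m" by (simp add: div_mult2_eq)
  with Suc obtain v where "base_word q (n div q) = base_word q (n div q div q ^ m) @ v"
    by metis
  moreover have "n div q > 0" using Suc.prems eq by (metis div_0 gr0I less_irrefl)
  ultimately show ?case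
    using base_word_snoc[OF assms(1), of "n div q" "n mod q"] assms(1) eq by simp
qed simp

text \<open>The fold is Horner's scheme started at \<open>n\<close>. Since \<open>n > 0\<close>,
  zeros at the beginning of \<open>u\<close> survive as letters.\<close>

lemma base_word_foldl:
  assumes "q \<ge> 2" "n > 0" "set u \<subseteq> {0..<q}"
  shows "base_word q (foldl (\<lambda>a x. a * q + x) n u) = base_word q n @ u"
  using assms(2,3)
proof (induction u arbitrary: n)
  case (Cons x u)
  then have "x < q" "n * q + x > 0" using assms(1) by auto
  then show ?case using Cons base_word_snoc[OF assms(1), of n x] by simp
qed simp

lemma foldl_digits_bounds:
  assumes "set u \<subseteq> {0..<q}"
  shows "n * q ^ length u \<le> foldl (\<lambda>a x. a * q + x) n u"
    and "foldl (\<lambda>a x. a * q + x) n u < Suc n * q ^ length u"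
proof -
  have "n * q ^ length u \<le> foldl (\<lambda>a x. a * q + x) n u \<and>
      foldl (\<lambda>a x. a * q + x) n u < Suc n * q ^ length u"
    using assms
  proof (induction u arbitrary: n)
    case (Cons x u)
    have "n * q \<le> n * q + x" "Suc (n * q + x) \<le> Suc n * q" using Cons.prems by auto
    then have "n * q * q ^ length u \<le> (n * q + x) * q ^ length u"
      "Suc (n * q + x) * q ^ length u \<le> Suc n * q * q ^ length u"
      by (intro mult_right_mono; simp)+
    moreover have "(n * q + x) * q ^ length u \<le> foldl (\<lambda>a x. a * q + x) (n * q + x) u \<and>
        foldl (\<lambda>a x. a * q + x) (n * q + x) u < Suc (n * q + x) * q ^ length u"
      using Cons.prems by (intro Cons.IH) auto
    ultimately show ?case
      unfolding foldl_Cons length_Cons power_Suc mult.assoc[symmetric] by linarith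
  qed simp
  then show "n * q ^ length u \<le> foldl (\<lambda>a x. a * q + x) n u"
    and "foldl (\<lambda>a x. a * q + x) n u < Suc n * q ^ length u" by auto
qed

section \<open>Counting occurrences in powers of a word\<close>

lemma finite_occurrence_positions:
  "finite {i. i + length u \<le> length v \<and> take (length u) (drop i v) = u}"
  by (rule finite_subset[of _ "{..length v}"]) auto

lemma occurrences_append_left: "occurrences w v \<le> occurrences w (u @ v)"
  unfolding occurrences_def
  by (rule card_inj_on_le[OF _ _ finite_occurrence_positions, where f = "\<lambda>i. length u + i"]) auto

text \<open>The occurrence removed by the subtraction in \<open>word_gamma\<close> is taken to be
  the second copy of \<open>w\<close>, so the remaining ones start inside the first copy.\<close>

lemma word_gamma_altdef:
  "word_gamma w = card {i. i < length w \<and> take (length w) (drop i (w @ w)) = w}"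
proof -
  let ?A = "{i. i < length w \<and> take (length w) (drop i (w @ w)) = w}"
  have "{i. i + length w \<le> length (w @ w) \<and> take (length w) (drop i (w @ w)) = w}
      = insert (length w) ?A" by auto
  then show ?thesis by (simp add: word_gamma_def word_gamma'_def occurrences_def)
qed

text \<open>An occurrence starting inside the first copy of \<open>w\<close> ends within
  \<open>w @ w\<close>, and there are \<open>word_gamma w\<close> of these. The occurrences in
  \<open>w @ v\<close>, shifted by \<open>length w\<close>, start later, so none is counted
  twice.\<close>

lemma occurrences_square_append:
  "word_gamma w + occurrences w (w @ v) \<le> occurrences w (w @ w @ v)"
proof -
  let ?l = "length w"
  let ?A = "{i. i < ?l \<and> take ?l (drop i (w @ w)) = w}"
  let ?B = "{i. i + ?l \<le> length (w @ v) \<and> take ?l (drop i (w @ v)) = w}"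
  let ?C = "{i. i + ?l \<le> length (w @ w @ v) \<and> take ?l (drop i (w @ w @ v)) = w}"
  have "?A \<union> (\<lambda>i. ?l + i) ` ?B \<subseteq> ?C" by auto
  then have "card (?A \<union> (\<lambda>i. ?l + i) ` ?B) \<le> card ?C"
    by (rule card_mono[OF finite_occurrence_positions])
  moreover have "card (?A \<union> (\<lambda>i. ?l + i) ` ?B) = card ?A + card ((\<lambda>i. ?l + i) ` ?B)"
    by (rule card_Un_disjoint) (auto intro: finite_occurrence_positions)
  moreover have "card ((\<lambda>i. ?l + i) ` ?B) = card ?B"
    by (rule card_image) simp
  ultimately show ?thesis
    unfolding word_gamma_altdef occurrences_def by simp
qed

text \<open>Each pair of adjacent copies contributes \<open>word_gamma w\<close>, and
  \<open>Suc r\<close> copies form \<open>r\<close> such pairs.\<close>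

lemma occurrences_power:
  "word_gamma w * r \<le> occurrences w (concat (replicate (Suc r) w) @ v)"
proof (induction r)
  case (Suc r)
  then show ?case
    using occurrences_square_append[of w "concat (replicate r w) @ v"] by simp
qed simp

section \<open>Gaps and growth of integer polynomials\<close>

lemma power_Suc_diff_le:
  fixes x :: int
  assumes "x \<ge> 0"
  shows "(x + 1) ^ i - x ^ i \<le> int i * (x + 1) ^ (i - 1)"
proof (cases i)
  case (Suc k)
  have "(x + 1) ^ Suc k - x ^ Suc k \<le> int (Suc k) * (x + 1) ^ k"
  proof (induction k)
    case (Suc k)
    have "(x + 1) ^ Suc (Suc k) - x ^ Suc (Suc k)
        = (x + 1) ^ Suc k + x * ((x + 1) ^ Suc k - x ^ Suc k)" by (simp add: algebra_simps)
    also have "x * ((x + 1) ^ Suc k - x ^ Suc k) \<le> (x + 1) * ((x + 1) ^ Suc k - x ^ Suc k)"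
      using assms by (intro mult_right_mono) (auto intro!: mult_mono power_mono)
    also have "\<dots> \<le> (x + 1) * (int (Suc k) * (x + 1) ^ k)"
      using Suc assms by (intro mult_left_mono) auto
    finally show ?case by (simp add: algebra_simps)
  qed simp
  then show ?thesis using Suc by simp
qed simp

text \<open>Bounding the increment term by term shows that consecutive values grow by at most a
  constant times the power of exponent \<open>degree f - 1\<close>. Absolute values are taken since
  lower coefficients may be negative.\<close>

lemma poly_diff_le:
  fixes f :: "int poly"
  assumes "x \<ge> 0"
  shows "poly f (x + 1) - poly f x
    \<le> (\<Sum>i\<le>degree f. \<bar>coeff f i\<bar>) * int (degree f) * (x + 1) ^ (degree f - 1)"
proof -
  have "poly f (x + 1) - poly f x = (\<Sum>i\<le>degree f. coeff f i * ((x + 1) ^ i - x ^ i))"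
    by (simp add: poly_altdef sum_subtractf right_diff_distrib)
  also have "\<dots> \<le> (\<Sum>i\<le>degree f. \<bar>coeff f i\<bar> * (int (degree f) * (x + 1) ^ (degree f - 1)))"
  proof (rule sum_mono)
    fix i assume i: "i \<in> {..degree f}"
    have nn: "0 \<le> (x + 1) ^ i - x ^ i" using assms by (simp add: power_mono)
    have "coeff f i * ((x + 1) ^ i - x ^ i) \<le> \<bar>coeff f i\<bar> * ((x + 1) ^ i - x ^ i)"
      using nn by (intro mult_right_mono) auto
    also have "(x + 1) ^ i - x ^ i \<le> int i * (x + 1) ^ (i - 1)"
      by (rule power_Suc_diff_le[OF assms])
    also have "\<dots> \<le> int (degree f) * (x + 1) ^ (degree f - 1)"
      using i assms by (intro mult_mono power_increasing) auto
    finally show "coeff f i * ((x + 1) ^ i - x ^ i)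
        \<le> \<bar>coeff f i\<bar> * (int (degree f) * (x + 1) ^ (degree f - 1))"
      by (simp add: mult_left_mono)
  qed
  also have "\<dots> = (\<Sum>i\<le>degree f. \<bar>coeff f i\<bar>) * int (degree f) * (x + 1) ^ (degree f - 1)"
    by (simp add: sum_distrib_right mult.assoc)
  finally show ?thesis .
qed

lemma poly_lead_approx:
  fixes f :: "int poly"
  assumes "degree f \<ge> 1" "x \<ge> 1"
  shows "\<bar>poly f x - lead_coeff f * x ^ degree f\<bar>
    \<le> (\<Sum>i<degree f. \<bar>coeff f i\<bar>) * x ^ (degree f - 1)"
proof -
  have "poly f x - lead_coeff f * x ^ degree f = (\<Sum>i<degree f. coeff f i * x ^ i)"
    by (simp add: poly_altdef flip: lessThan_Suc_atMost)
  also have "\<bar>\<dots>\<bar> \<le> (\<Sum>i<degree f. \<bar>coeff f i * x ^ i\<bar>)" by (rule sum_abs)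
  also have "\<dots> \<le> (\<Sum>i<degree f. \<bar>coeff f i\<bar> * x ^ (degree f - 1))"
    using assms by (intro sum_mono) (auto simp: abs_mult intro!: mult_left_mono power_increasing)
  finally show ?thesis by (simp add: sum_distrib_right)
qed

text \<open>A negative leading coefficient would eventually make the values negative, so by
  integrality it is at least 1. The factor 2 leaves half of the leading power to absorb the
  lower-order terms.\<close>

lemma poly_ge_half_power:
  fixes f :: "int poly"
  assumes "degree f \<ge> 1" "\<And>n::nat. poly f (int n) \<ge> 0"
  obtains n0 :: nat where "\<And>n. n \<ge> n0 \<Longrightarrow> int n ^ degree f \<le> 2 * poly f (int n)"
proof -
  define S where "S = (\<Sum>i<degree f. \<bar>coeff f i\<bar>)"
  have S: "S \<ge> 0" by (simp add: S_def sum_nonneg)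
  have pow: "int n ^ degree f = int n * int n ^ (degree f - 1)" for n
    using assms(1) by (simp flip: power_Suc)
  have approx: "\<bar>poly f (int n) - lead_coeff f * int n ^ degree f\<bar> \<le> S * int n ^ (degree f - 1)"
    if "n \<ge> 1" for n
    using poly_lead_approx[OF assms(1), of "int n"] that by (simp add: S_def)
  have "lead_coeff f \<ge> 1"
  proof (rule ccontr)
    assume "\<not> lead_coeff f \<ge> 1"
    moreover have "lead_coeff f \<noteq> 0" using assms(1) by auto
    ultimately have lc: "lead_coeff f \<le> -1" by linarith
    \<comment> \<open>One more than \<open>S\<close>, so that the negative leading term already
      outweighs the bound on all the others.\<close>
    define n where "n = nat (S + 1)"
    have n: "n \<ge> 1" "int n = S + 1" using S by (auto simp: n_def)
    have "lead_coeff f * int n ^ degree f \<le> (-1) * int n ^ degree f"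
      by (rule mult_right_mono[OF lc]) simp
    then have "poly f (int n) \<le> S * int n ^ (degree f - 1) - int n ^ degree f"
      using approx[OF n(1)] by linarith
    also have "\<dots> = - (int n ^ (degree f - 1))"
      using pow[of n] n(2) by (simp add: algebra_simps)
    also have "\<dots> < 0" using n(1) by simp
    finally show False using assms(2)[of n] by linarith
  qed
  show thesis
  proof (rule that)
    fix n assume "n \<ge> nat (2 * S + 1)"
    then have n: "n \<ge> 1" "int n \<ge> 2 * S" using S by linarith+
    have "1 * int n ^ degree f \<le> lead_coeff f * int n ^ degree f"
      using \<open>lead_coeff f \<ge> 1\<close> by (intro mult_right_mono) auto
    moreover have "2 * S * int n ^ (degree f - 1) \<le> int n * int n ^ (degree f - 1)"
      using n by (intro mult_right_mono) auto
    ultimately show "int n ^ degree f \<le> 2 * poly f (int n)"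
      using approx[OF n(1)] pow[of n] by linarith
  qed
qed

section \<open>Prescribing the leading digits of a polynomial value\<close>

text \<open>A discrete intermediate value argument without monotonicity: the first index with value
  at least \<open>A\<close> follows a value below \<open>A\<close>, so it overshoots by less than
  \<open>D\<close>. The bound up to \<open>M\<close> forces this index beyond
  \<open>M\<close>.\<close>

lemma int_crossing:
  fixes g :: "nat \<Rightarrow> int"
  assumes "\<And>n. n \<le> M \<Longrightarrow> g n < A" "A \<le> g N" "\<And>n. n < N \<Longrightarrow> g (Suc n) - g n \<le> D"
  obtains n where "M \<le> n" "n \<le> N" "A \<le> g n" "g n < A + D"
proof -
  define n where "n = (LEAST n. A \<le> g n)"
  have n: "A \<le> g n" "n \<le> N"
    using assms(2) by (auto simp: n_def intro: LeastI Least_le)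
  have "n > M" using n(1) assms(1)[of n] by force
  then have "\<not> A \<le> g (n - 1)"
    using not_less_Least[of "n - 1" "\<lambda>n. A \<le> g n"] by (simp add: n_def)
  moreover have "g (Suc (n - 1)) - g (n - 1) \<le> D"
    using \<open>n > M\<close> n(2) by (intro assms(3)) auto
  ultimately show thesis using that[of n] n \<open>n > M\<close> by simp
qed

text \<open>With \<open>m = q ^ K * t ^ (degree f - 1)\<close>, the quotient is \<open>W\<close>
  exactly on the interval from \<open>W * m\<close> to below \<open>Suc W * m\<close>. Its length is
  at least every gap met up to \<open>B * t\<close>, so the values cannot jump over it. It matters
  that \<open>B\<close> and \<open>K\<close> depend on neither \<open>t\<close> nor
  \<open>M\<close>.\<close>

lemma poly_leading_digits:
  fixes f :: "int poly" and q :: nat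
  assumes q: "q \<ge> 2" and d: "degree f \<ge> 1" and nonneg: "\<And>n::nat. poly f (int n) \<ge> 0"
  obtains B K :: nat where "B \<ge> 1"
    "\<And>M. \<exists>t0. \<forall>t\<ge>t0. \<forall>W. t \<le> W \<and> W < 2 * t \<longrightarrow>
       (\<exists>n. M \<le> n \<and> n \<le> B * t \<and>
         nat (poly f (int n)) div (q ^ K * t ^ (degree f - 1)) = W)"
proof -
  let ?e = "degree f - 1"
  define C where "C = nat ((\<Sum>i\<le>degree f. \<bar>coeff f i\<bar>) * int (degree f)) + 1"
  have C: "C \<ge> 1" by (simp add: C_def)
  have gap: "poly f (int (Suc n)) - poly f (int n) \<le> int (C * Suc n ^ ?e)" for n
  proof -
    have "poly f (int n + 1) - poly f (int n)
        \<le> (\<Sum>i\<le>degree f. \<bar>coeff f i\<bar>) * int (degree f) * (int n + 1) ^ ?e"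
      by (rule poly_diff_le) simp
    also have "\<dots> \<le> int C * (int n + 1) ^ ?e"
      by (intro mult_right_mono) (auto simp: C_def)
    finally show ?thesis by (simp add: add.commute)
  qed
  \<comment> \<open>The 4 pays for \<open>W < 2 * t\<close> and for the factor 2 in
    \<open>poly_ge_half_power\<close>. The \<open>q\<close> pays for rounding
    \<open>C * B ^ ?e\<close> up to a power of \<open>q\<close> when \<open>K\<close> is
    chosen.\<close>
  define B where "B = 4 * q * C"
  have B: "B \<ge> 1" using q C by (simp add: B_def)
  have "C * B ^ ?e \<ge> 1" using C B by simp
  then obtain k where k: "q ^ k \<le> C * B ^ ?e" "C * B ^ ?e < q ^ (k + 1)"
    using ex_power_ivl1[OF q] by blast
  define K where "K = Suc k"
  have K: "C * B ^ ?e \<le> q ^ K" "q ^ K \<le> q * (C * B ^ ?e)"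
    using k by (simp_all add: K_def)
  obtain n0 where n0: "\<And>n. n \<ge> n0 \<Longrightarrow> int n ^ degree f \<le> 2 * poly f (int n)"
    using poly_ge_half_power[OF d nonneg] by blast
  have pow: "x ^ degree f = x * x ^ ?e" for x :: nat
    using d by (simp flip: power_Suc)
  have "\<exists>n. M \<le> n \<and> n \<le> B * t \<and> nat (poly f (int n)) div (q ^ K * t ^ ?e) = W"
    \<comment> \<open>The sum keeps all values up to \<open>M\<close> below \<open>t\<close>, hence
      below \<open>W * m\<close>; \<open>n0\<close> makes the growth bound available at
      \<open>B * t\<close>.\<close>
    if t: "t \<ge> n0 + 1 + (\<Sum>i\<le>M. nat (poly f (int i)))" and W: "t \<le> W" "W < 2 * t" for M t W
  proof -
    define m where "m = q ^ K * t ^ ?e"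
    have t1: "t \<ge> 1" using t by simp
    have m: "m \<ge> 1" using q t1 by (simp add: m_def)
    have "B * t \<ge> 1 * t" using B by (intro mult_right_mono) auto
    then have Bt: "B * t \<ge> n0" using t by linarith
    have small: "poly f (int n) < int (W * m)" if "n \<le> M" for n
    proof -
      have "nat (poly f (int n)) \<le> (\<Sum>i\<le>M. nat (poly f (int i)))"
        using that by (intro member_le_sum) auto
      also have "\<dots> < t" using t by simp
      also have "t * 1 \<le> W * m" using W(1) m by (intro mult_mono) auto
      finally show ?thesis using nonneg[of n] by linarith
    qed
    have large: "int (W * m) \<le> poly f (int (B * t))"
    proof -
      have "2 * (W * m) \<le> 2 * (2 * t * (q * (C * B ^ ?e) * t ^ ?e))"
        unfolding m_def using W(2) K(2) by (intro mult_mono) auto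
      also have "\<dots> = (B * t) ^ degree f"
        unfolding pow by (simp add: B_def power_mult_distrib)
      finally have "int (2 * (W * m)) \<le> int ((B * t) ^ degree f)" by (simp only: of_nat_le_iff)
      then show ?thesis using n0[OF Bt] by simp
    qed
    have gaps: "poly f (int (Suc n)) - poly f (int n) \<le> int m" if "n < B * t" for n
    proof -
      have "C * Suc n ^ ?e \<le> C * (B * t) ^ ?e"
        using that by (intro mult_left_mono power_mono) auto
      also have "\<dots> = (C * B ^ ?e) * t ^ ?e" by (simp add: power_mult_distrib)
      also have "\<dots> \<le> m" unfolding m_def using K(1) by (intro mult_right_mono) auto
      finally show ?thesis using gap[of n] by linarith
    qed
    obtain n where n: "M \<le> n" "n \<le> B * t" "int (W * m) \<le> poly f (int n)"
        "poly f (int n) < int (W * m) + int m"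
      using int_crossing[of M "\<lambda>n. poly f (int n)", OF small large gaps] by blast
    have "W * m \<le> nat (poly f (int n))" "nat (poly f (int n)) < Suc W * m"
      using n(3,4) by (simp_all add: nat_less_iff le_nat_iff nonneg algebra_simps)
    then have "nat (poly f (int n)) div m = W"
      by (intro div_nat_eqI) (simp_all add: mult.commute)
    then show ?thesis using n(1,2) by (auto simp: m_def)
  qed
  then show thesis by (intro that[OF B]) blast
qed

section \<open>The lower bound for the limit superior\<close>

theorem theorem1p1:
  fixes q d l :: nat and f :: "int poly" and w :: "nat list"
  assumes "q \<ge> 2"
    and "degree f = d" and "d \<ge> 1"
    and "\<And>n::nat. poly f (int n) \<ge> 0"
    and "set w \<subseteq> {0..<q}"
    and "length w = l" and "l \<ge> 1"
  shows "limsup (\<lambda>n::nat. ereal (real (digit_block_count q w (nat (poly f (int n)))) / ln (real n)))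
         \<ge> ereal (real (word_gamma w) / (real l * ln (real q)))"
proof -
  have deg: "degree f \<ge> 1" using assms by simp
  obtain B K where B: "B \<ge> 1" and digits: "\<And>M. \<exists>t0. \<forall>t\<ge>t0. \<forall>W. t \<le> W \<and> W < 2 * t \<longrightarrow>
       (\<exists>n. M \<le> n \<and> n \<le> B * t \<and>
         nat (poly f (int n)) div (q ^ K * t ^ (degree f - 1)) = W)"
    using poly_leading_digits[OF assms(1) deg assms(4)] by blast
  \<comment> \<open>The ratio guaranteed by \<open>Suc r\<close> copies of \<open>w\<close>: the
    denominator is \<open>ln (B * t)\<close> for \<open>t = q ^ (Suc r * l)\<close>, an upper bound
    for \<open>ln n\<close>.\<close>
  define g where "g r = real (word_gamma w * r) / (ln B + real (Suc r) * (l * ln q))" for r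
  have lq: "real l * ln (real q) > 0" using assms by simp
  have g: "(\<lambda>r. ereal (g r)) \<longlonglongrightarrow> ereal (word_gamma w / (l * ln q))"
  proof -
    have "(\<lambda>r. a * real r / (b + real (Suc r) * c)) \<longlonglongrightarrow> a / c" if "c > 0" for a b c :: real
      using that unfolding divide_inverse by real_asymp
    from this[OF lq] show ?thesis unfolding g_def by (intro tendsto_ereal) simp
  qed
  show ?thesis
  proof (rule dense_le)
    fix y assume y: "y < ereal (word_gamma w / (l * ln q))"
    have "\<exists>\<^sub>F n in sequentially.
        y < ereal (real (digit_block_count q w (nat (poly f (int n)))) / ln (real n))"
      unfolding frequently_sequentially
    proof
      fix M
      \<comment> \<open>Requiring \<open>n \<ge> M + 2\<close> also makes \<open>ln n\<close>
        positive.\<close>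
      obtain t0 where t0: "\<And>t W. t \<ge> t0 \<Longrightarrow> t \<le> W \<Longrightarrow> W < 2 * t \<Longrightarrow>
         (\<exists>n\<ge>M + 2. n \<le> B * t \<and> nat (poly f (int n)) div (q ^ K * t ^ (degree f - 1)) = W)"
        using digits[of "M + 2"] by blast
      obtain r where r: "y < ereal (g r)" "r \<ge> t0"
        using eventually_conj[OF order_tendstoD(1)[OF g y] eventually_ge_at_top[of t0]]
        by (metis (mono_tags, lifting) eventually_happens' sequentially_bot)
      define u where "u = concat (replicate (Suc r) w)"
      have u: "set u \<subseteq> {0..<q}" "length u = Suc r * l"
        using assms(5,6) by (auto simp: u_def length_concat sum_list_replicate)
      \<comment> \<open>As \<open>t\<close> is a power of \<open>q\<close>, so is the divisor in
        \<open>digits\<close>, and dividing by it deletes trailing digits. Starting the fold at 1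
        gives \<open>W\<close> the word \<open>1u\<close> and places it between \<open>t\<close> and
        \<open>2 * t\<close>.\<close>
      define t where "t = q ^ length u"
      define W where "W = foldl (\<lambda>a x. a * q + x) 1 u"
      have W: "t \<le> W" "W < 2 * t"
        using foldl_digits_bounds[OF u(1), of 1] by (simp_all add: t_def W_def)
      have "r \<le> length u" using u(2) assms(7) by (simp add: trans_le_add2)
      also have "length u < t"
        unfolding t_def by (rule power_gt_expt) (use assms(1) in simp)
      finally have "t \<ge> t0" using r(2) by simp
      then obtain n where n: "n \<ge> M + 2" "n \<le> B * t"
          "nat (poly f (int n)) div (q ^ K * t ^ (degree f - 1)) = W"
        using t0 W by blast
      have "q ^ K * t ^ (degree f - 1) = q ^ (K + length u * (degree f - 1))"
        by (simp add: t_def power_add power_mult)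
      then obtain v where "base_word q (nat (poly f (int n))) = base_word q W @ v"
        using base_word_prefix[OF assms(1), of "nat (poly f (int n))"] n(3) W
        by (metis gr_zeroI leD le_0_eq mult_0_right not_less_zero)
      moreover have "base_word q W = base_word q 1 @ u"
        unfolding W_def by (rule base_word_foldl) (use assms(1) u in auto)
      ultimately have "word_gamma w * r \<le> digit_block_count q w (nat (poly f (int n)))"
        unfolding digit_block_count_def u_def
        using occurrences_power[of w r v] occurrences_append_left order_trans
        by (metis append.assoc)
      moreover have "ln (real n) \<le> ln B + real (Suc r) * (l * ln q)"
      proof -
        have "ln (real n) \<le> ln (real (B * t))"
          using n(1,2) by (intro ln_mono) (simp_all del: of_nat_mult)
        also have "\<dots> = ln B + real (Suc r) * (l * ln q)"
          using B assms(1) u(2) by (simp add: t_def ln_mult ln_realpow algebra_simps)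
        finally show ?thesis .
      qed
      moreover have "ln (real n) > 0" using n(1) by simp
      ultimately have "g r \<le> real (digit_block_count q w (nat (poly f (int n)))) / ln (real n)"
        unfolding g_def by (intro frac_le) (simp_all del: of_nat_mult of_nat_Suc)
      then have "y < ereal (real (digit_block_count q w (nat (poly f (int n)))) / ln (real n))"
        using r(1) by (meson ereal_less_eq(3) less_le_trans)
      then show "\<exists>n\<ge>M. y < ereal (real (digit_block_count q w (nat (poly f (int n)))) / ln (real n))"
        using n(1) by (intro exI[of _ n]) auto
    qed
    \<comment> \<open>If the limit superior were below \<open>y\<close>, the ratios would eventually
      stay below \<open>y\<close>.\<close>
    then show "y \<le> limsup (\<lambda>n.
        ereal (real (digit_block_count q w (nat (poly f (int n)))) / ln (real n)))"
      by (rule contrapos_pp) (auto simp: not_le not_frequently not_less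
          dest!: Limsup_lessD elim: eventually_mono)
  qed
qed

end
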